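(* Let $k: \Omega \times \Omega \to \mathbb{R}^{m \times m}$ be a separable kernel of order $1$ with decomposition $(k_1,Q_1)$, where $k_1$ is a positive definite scalar-valued kernel and $Q_1\in\mathbb{R}^{m\times m}$ is positive semi-definite. Let $X_n = \{x_1,\dots,x_n\} \subset \Omega$ be a set of pairwise distinct points. Let $\mathcal{N} := \operatorname{span}\{k(\cdot,x_j)\alpha \mid x_j\in X_n,\ \alpha\in\mathbb{R}^m\}$, $\hat{\mathcal{N}} := \operatorname{span}\{k_1(\cdot,x_j) \mid x_j \in X_n\}$, and let $\mathcal{P}_{\hat{\mathcal{N}}}$ denote the power-function of $\hat{\mathcal N}$ for the scalar-valued kernel $k_1$. Then for all $x\in\Omega$ and $\alpha\in\mathbb{R}^m$, $$\left(\mathcal{P}_{\mathcal{N}}^{\alpha}(x)\right)^2 = \mathcal{P}_{\hat{\mathcal{N}}}(x)^2\, \alpha^TQ_1\alpha.$$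
   Context: $\Omega$ is a nonempty set, $m\in\mathbb{N}$. A matrix-valued kernel is a function $k : \Omega\times\Omega\to\mathbb{R}^{m\times m}$ with $k(x,y)=k(y,x)^T$ for all $x,y$; a scalar-valued kernel is the case $m=1$. $k$ is positive definite if for every finite $\{x_1,\dots,x_n\}\subset\Omega$ the block matrix $(k(x_i,x_j))_{i,j=1}^n$ is positive semi-definite. The RKHS of a positive definite matrix-valued kernel $k$ is the unique real Hilbert space $\mathcal{H}$ of functions $\Omega\to\mathbb{R}^m$ such that $k(\cdot,x)\alpha\in\mathcal{H}$ and $\langle f,k(\cdot,x)\alpha\rangle_{\mathcal{H}}=f(x)^T\alpha$ for all $x\in\Omega$, $\alpha\in\mathbb{R}^m$, $f\in\mathcal{H}$. For a closed subspace $\mathcal{N}\subset\mathcal{H}$ with orthogonal projection $\Pi_{\mathcal{N}}$, the power-function is $\mathcal{P}_{\mathcal{N}}^{\alpha}(x):=\sup_{f\in\mathcal{H}\setminus\{0\}}\frac{|(f(x)-(\Pi_{\mathcal{N}}f)(x))^T\alpha|}{\|f\|_{\mathcal{H}}}$; here $\mathcal{P}_{\mathcal{N}}^\alpha$ is taken in the RKHS of $k$. In the scalar case ($m=1$), $\mathcal{P}_{\hat{\mathcal{N}}}(x):=\sup_{f\ne 0}\frac{|f(x)-(\Pi_{\hat{\mathcal{N}}}f)(x)|}{\|f\|}$ over the RKHS of $k_1$. A kernel $k$ has decomposition $(k_i,Q_i)_{i=1}^p$ of length $p$ if $k_i$ are scalar-valued kernels, $Q_i\in\mathbb{R}^{m\times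 m}$ are symmetric and $k(x,y)=\sum_{i=1}^pk_i(x,y)Q_i$ for all $x,y$; $k$ is separable of order $p$ if $p$ is the minimal length of a decomposition of $k$. *)

theory Defs
  imports "HOL-Analysis.Analysis" "HOL-Library.Function_Algebras"
begin

text \<open>
  The set \<open>\<Omega>\<close> is the (automatically nonempty) type \<open>'a\<close>, and \<open>m\<close> is \<open>CARD('m)\<close>.
  Scalar-valued kernels are real-valued instead of being valued in \<open>1 \<times> 1\<close> matrices.
\<close>

text \<open>Pointwise scaling, so that \<open>subspace\<close> and \<open>span\<close> are available for spaces of functions.\<close>

instantiation "fun" :: (type, real_vector) real_vector
begin

definition scaleR_fun :: "real \<Rightarrow> ('a \<Rightarrow> 'b) \<Rightarrow> 'a \<Rightarrow> 'b"
  where "scaleR_fun c f = (\<lambda>x. c *\<^sub>R f x)"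

instance
  by standard (simp_all add: scaleR_fun_def fun_eq_iff scaleR_add_right scaleR_add_left)

end

section \<open>Kernels\<close>

definition matrix_kernel :: "('a \<Rightarrow> 'a \<Rightarrow> real^'m^'m) \<Rightarrow> bool"
  where "matrix_kernel k \<longleftrightarrow> (\<forall>x y. k x y = transpose (k y x))"

definition scalar_kernel :: "('a \<Rightarrow> 'a \<Rightarrow> real) \<Rightarrow> bool"
  where "scalar_kernel k \<longleftrightarrow> (\<forall>x y. k x y = k y x)"

definition psd_matrix :: "real^'m^'m \<Rightarrow> bool"
  where "psd_matrix A \<longleftrightarrow> transpose A = A \<and> (\<forall>v. 0 \<le> v \<bullet> (A *v v))"

text \<open>The double sum is the quadratic form of the Gram matrix \<open>(k x y)\<close> with \<open>x, y \<in> X\<close>.\<close>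

definition pos_def_scalar_kernel :: "('a \<Rightarrow> 'a \<Rightarrow> real) \<Rightarrow> bool"
  where "pos_def_scalar_kernel k \<longleftrightarrow> scalar_kernel k \<and>
    (\<forall>X c. finite X \<longrightarrow> 0 \<le> (\<Sum>x\<in>X. \<Sum>y\<in>X. c x * k x y * c y))"

text \<open>A decomposition is the list of its pairs; its length is the length of the list.\<close>

definition kernel_decomposition ::
    "('a \<Rightarrow> 'a \<Rightarrow> real^'m^'m) \<Rightarrow> (('a \<Rightarrow> 'a \<Rightarrow> real) \<times> (real^'m^'m)) list \<Rightarrow> bool"
  where "kernel_decomposition k ds \<longleftrightarrow>
    (\<forall>(\<kappa>, Q) \<in> set ds. scalar_kernel \<kappa> \<and> transpose Q = Q) \<and>
    (\<forall>x y. k x y = (\<Sum>(\<kappa>, Q)\<leftarrow>ds. \<kappa> x y *\<^sub>R Q))"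

text \<open>Lengths are positive, so the zero kernel is separable of order 1.\<close>

definition separable_of_order :: "('a \<Rightarrow> 'a \<Rightarrow> real^'m^'m) \<Rightarrow> nat \<Rightarrow> bool"
  where "separable_of_order k p \<longleftrightarrow> 1 \<le> p \<and>
    (\<exists>ds. kernel_decomposition k ds \<and> length ds = p) \<and>
    (\<forall>ds. kernel_decomposition k ds \<and> 1 \<le> length ds \<longrightarrow> p \<le> length ds)"

section \<open>Hilbert spaces of functions\<close>

text \<open>
  A Hilbert space of functions is a carrier \<open>H\<close> with an inner product \<open>ip\<close>, which is
  constrained on \<open>H\<close> only.
\<close>

definition ip_norm :: "('f \<Rightarrow> 'f \<Rightarrow> real) \<Rightarrow> 'f \<Rightarrow> real"
  where "ip_norm ip f = sqrt (ip f f)"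

definition hilbert_function_space ::
    "('a \<Rightarrow> 'b::real_vector) set \<Rightarrow> (('a \<Rightarrow> 'b) \<Rightarrow> ('a \<Rightarrow> 'b) \<Rightarrow> real) \<Rightarrow> bool"
  where "hilbert_function_space H ip \<longleftrightarrow>
    subspace H \<and>
    (\<forall>f\<in>H. \<forall>g\<in>H. ip f g = ip g f) \<and>
    (\<forall>f\<in>H. \<forall>g\<in>H. \<forall>h\<in>H. ip (f + g) h = ip f h + ip g h) \<and>
    (\<forall>c. \<forall>f\<in>H. \<forall>g\<in>H. ip (c *\<^sub>R f) g = c * ip f g) \<and>
    (\<forall>f\<in>H. 0 \<le> ip f f) \<and>
    (\<forall>f\<in>H. ip f f = 0 \<longrightarrow> f = 0) \<and>
    (\<forall>s::nat \<Rightarrow> 'a \<Rightarrow> 'b. (\<forall>n. s n \<in> H) \<and>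
        (\<forall>e>0. \<exists>N. \<forall>i\<ge>N. \<forall>j\<ge>N. ip_norm ip (s i - s j) < e) \<longrightarrow>
      (\<exists>f\<in>H. (\<lambda>n. ip_norm ip (s n - f)) \<longlonglongrightarrow> 0))"

definition is_rkhs ::
    "('a \<Rightarrow> 'a \<Rightarrow> real^'m^'m) \<Rightarrow> ('a \<Rightarrow> real^'m) set \<Rightarrow>
      (('a \<Rightarrow> real^'m) \<Rightarrow> ('a \<Rightarrow> real^'m) \<Rightarrow> real) \<Rightarrow> bool"
  where "is_rkhs k H ip \<longleftrightarrow> hilbert_function_space H ip \<and>
    (\<forall>x \<alpha>. (\<lambda>y. k y x *v \<alpha>) \<in> H \<and> (\<forall>f\<in>H. ip f (\<lambda>y. k y x *v \<alpha>) = f x \<bullet> \<alpha>))"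

definition is_scalar_rkhs ::
    "('a \<Rightarrow> 'a \<Rightarrow> real) \<Rightarrow> ('a \<Rightarrow> real) set \<Rightarrow> (('a \<Rightarrow> real) \<Rightarrow> ('a \<Rightarrow> real) \<Rightarrow> real) \<Rightarrow> bool"
  where "is_scalar_rkhs k H ip \<longleftrightarrow> hilbert_function_space H ip \<and>
    (\<forall>x. (\<lambda>y. k y x) \<in> H \<and> (\<forall>f\<in>H. ip f (\<lambda>y. k y x) = f x))"

definition orth_projection :: "('f::ab_group_add \<Rightarrow> 'f \<Rightarrow> real) \<Rightarrow> 'f set \<Rightarrow> 'f \<Rightarrow> 'f"
  where "orth_projection ip N f = (THE g. g \<in> N \<and> (\<forall>h\<in>N. ip (f - g) h = 0))"

text \<open>
  Over the zero space the supremum is taken in \<open>[0, \<infinity>)\<close>, hence is 0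
  (\<open>Sup {}\<close> is unspecified on the reals).
\<close>

definition power_function ::
    "('a \<Rightarrow> real^'m) set \<Rightarrow> (('a \<Rightarrow> real^'m) \<Rightarrow> ('a \<Rightarrow> real^'m) \<Rightarrow> real) \<Rightarrow>
      ('a \<Rightarrow> real^'m) set \<Rightarrow> real^'m \<Rightarrow> 'a \<Rightarrow> real"
  where "power_function H ip N \<alpha> x =
    (if H = {0} then 0
     else SUP f\<in>H - {0}. \<bar>(f x - orth_projection ip N f x) \<bullet> \<alpha>\<bar> / ip_norm ip f)"

definition scalar_power_function ::
    "('a \<Rightarrow> real) set \<Rightarrow> (('a \<Rightarrow> real) \<Rightarrow> ('a \<Rightarrow> real) \<Rightarrow> real) \<Rightarrow>
      ('a \<Rightarrow> real) set \<Rightarrow> 'a \<Rightarrow> real"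
  where "scalar_power_function H ip N x =
    (if H = {0} then 0
     else SUP f\<in>H - {0}. \<bar>f x - orth_projection ip N f x\<bar> / ip_norm ip f)"

end

theory Submission
  imports Defs
begin

text \<open>
  Evaluation of \<open>f - \<Pi> f\<close> at \<open>x\<close> in direction \<open>\<alpha>\<close> is the inner product of \<open>f - \<Pi> f\<close> with
  the representer \<open>r = k(\<cdot>, x) \<alpha>\<close>. As \<open>\<Pi>\<close> is self-adjoint, this is the inner product of \<open>f\<close>
  with the residual \<open>r - \<Pi> r\<close>, so by Cauchy--Schwarz the power function is the norm of
  that residual. Its square is the inner product of \<open>r - \<Pi> r\<close> with \<open>r\<close>, which by the
  reproducing property is again just an evaluation of the residual at \<open>x\<close>
  (\<open>power_sup_squared\<close>).

  It remains to compare residuals. Because \<open>k = k\<^sub>1 Q\<^sub>1\<close>, the representer of \<open>k\<close> is the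
  representer of \<open>k\<^sub>1\<close> times the constant vector \<open>Q\<^sub>1 \<alpha>\<close>. The trial spaces are spanned by
  kernel sections at the points \<open>x\<^sub>j\<close>, so by the reproducing property a function that
  vanishes at every \<open>x\<^sub>j\<close> is orthogonal to them, and conversely. Hence the scalar residual
  times \<open>Q\<^sub>1 \<alpha>\<close> is the residual for \<open>k\<close>, and evaluating it at \<open>x\<close> against \<open>\<alpha>\<close> gives the
  factor \<open>\<alpha>\<^sup>T Q\<^sub>1 \<alpha>\<close>.

  Both trial spaces are finitely generated (\<open>kernel_span_finitely_generated\<close>), so the
  projections onto them come from the Gram--Schmidt procedure (\<open>projection_exists\<close>).
\<close>

section \<open>Projections and power functions in an inner product space\<close>

locale carrier_inner_product =
  fixes H :: "'f::real_vector set" and ip :: "'f \<Rightarrow> 'f \<Rightarrow> real"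
  assumes subspace_H: "subspace H"
    and ip_commute: "f \<in> H \<Longrightarrow> g \<in> H \<Longrightarrow> ip f g = ip g f"
    and ip_add_left: "f \<in> H \<Longrightarrow> g \<in> H \<Longrightarrow> h \<in> H \<Longrightarrow> ip (f + g) h = ip f h + ip g h"
    and ip_scale_left: "f \<in> H \<Longrightarrow> g \<in> H \<Longrightarrow> ip (c *\<^sub>R f) g = c * ip f g"
    and ip_nonneg: "f \<in> H \<Longrightarrow> 0 \<le> ip f f"
    and ip_definite: "f \<in> H \<Longrightarrow> ip f f = 0 \<Longrightarrow> f = 0"
begin

lemmas H_closed [simp] =
  subspace_0[OF subspace_H] subspace_add[OF subspace_H]
  subspace_diff[OF subspace_H] subspace_scale[OF subspace_H]

lemma ip_diff_left: "f \<in> H \<Longrightarrow> g \<in> H \<Longrightarrow> h \<in> H \<Longrightarrow> ip (f - g) h = ip f h - ip g h"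
  using ip_add_left[of "f - g" g h] by simp

lemma ip_add_right: "f \<in> H \<Longrightarrow> g \<in> H \<Longrightarrow> h \<in> H \<Longrightarrow> ip f (g + h) = ip f g + ip f h"
  by (simp add: ip_commute[of f] ip_add_left)

lemma ip_diff_right: "f \<in> H \<Longrightarrow> g \<in> H \<Longrightarrow> h \<in> H \<Longrightarrow> ip f (g - h) = ip f g - ip f h"
  by (simp add: ip_commute[of f] ip_diff_left)

lemma ip_scale_right: "f \<in> H \<Longrightarrow> g \<in> H \<Longrightarrow> ip f (c *\<^sub>R g) = c * ip f g"
  by (simp add: ip_commute[of f] ip_scale_left)

lemma ip_zero_left: "f \<in> H \<Longrightarrow> ip 0 f = 0"
  using ip_scale_left[of 0 f 0] by simp

lemma ip_zero_right: "f \<in> H \<Longrightarrow> ip f 0 = 0"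
  using ip_scale_right[of f 0 0] by simp

lemma ip_norm_pos:
  assumes "f \<in> H" "f \<noteq> 0"
  shows "0 < ip_norm ip f"
  using assms ip_nonneg[of f] ip_definite[of f] by (auto simp: ip_norm_def less_le)

lemma ip_norm_squared: "f \<in> H \<Longrightarrow> (ip_norm ip f)\<^sup>2 = ip f f"
  by (simp add: ip_norm_def ip_nonneg)

lemma Cauchy_Schwarz:
  assumes f: "f \<in> H" and g: "g \<in> H"
  shows "\<bar>ip f g\<bar> \<le> ip_norm ip f * ip_norm ip g"
proof (cases "g = 0")
  case True
  then show ?thesis using f by (simp add: ip_zero_right ip_norm_def ip_zero_left)
next
  case False
  then have pos: "0 < ip g g"
    using ip_nonneg[OF g] ip_definite[OF g] by (auto simp: less_le)
  define c where "c = ip f g / ip g g"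
  have "0 \<le> ip (f - c *\<^sub>R g) (f - c *\<^sub>R g)"
    using f g by (intro ip_nonneg) simp
  also have "\<dots> = ip f f - 2 * c * ip f g + c\<^sup>2 * ip g g"
    using f g by (simp add: ip_diff_left ip_diff_right ip_scale_left ip_scale_right
        ip_commute[of g f] power2_eq_square algebra_simps)
  also have "\<dots> = ip f f - (ip f g)\<^sup>2 / ip g g"
    using pos by (simp add: c_def power2_eq_square field_simps)
  finally have "(ip f g)\<^sup>2 \<le> ip f f * ip g g"
    using pos by (simp add: field_simps)
  then have "sqrt ((ip f g)\<^sup>2) \<le> sqrt (ip f f * ip g g)"
    by (rule real_sqrt_le_mono)
  then show ?thesis
    by (simp add: ip_norm_def real_sqrt_mult)
qed

lemma orthogonal_span:
  assumes f: "f \<in> H" and B: "B \<subseteq> H" and orth: "\<And>b. b \<in> B \<Longrightarrow> ip f b = 0"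
    and h: "h \<in> span B"
  shows "ip f h = 0"
proof -
  have "subspace {h \<in> H. ip f h = 0}"
    using f by (auto simp: subspace_def ip_zero_right ip_add_right ip_scale_right)
  moreover have "B \<subseteq> {h \<in> H. ip f h = 0}"
    using B orth by auto
  ultimately show ?thesis
    using h span_minimal by blast
qed

lemma span_subset_H: "B \<subseteq> H \<Longrightarrow> span B \<subseteq> H"
  by (simp add: span_minimal subspace_H)

text \<open>
  One Gram--Schmidt step per generator: a new generator \<open>b\<close> is replaced by its residual
  \<open>b - p\<close>, and the projection is corrected along that residual unless it vanishes.
\<close>

lemma projection_exists:
  assumes "finite B" "B \<subseteq> H" "f \<in> H"
  shows "\<exists>g \<in> span B. \<forall>h \<in> span B. ip (f - g) h = 0"
proof -
  have "\<exists>g \<in> span B. \<forall>b \<in> B. ip (f - g) b = 0"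
    using assms
  proof (induction B arbitrary: f rule: finite_induct)
    case empty
    show ?case by (intro bexI[of _ 0]) simp_all
  next
    case (insert b B)
    have b: "b \<in> H" and B: "B \<subseteq> H" and f: "f \<in> H"
      using insert.prems by auto
    obtain p where p: "p \<in> span B" and p_orth: "\<forall>h\<in>B. ip (b - p) h = 0"
      using insert.IH[OF B b] by blast
    obtain g where g: "g \<in> span B" and g_orth: "\<forall>h\<in>B. ip (f - g) h = 0"
      using insert.IH[OF B f] by blast
    have pH: "p \<in> H" and gH: "g \<in> H"
      using p g span_subset_H[OF B] by auto
    define d where "d = b - p"
    have d: "d \<in> H" using b pH by (simp add: d_def)
    \<comment> \<open>If \<open>d = 0\<close>, this coefficient is \<open>0\<close> by the convention for division by zero.\<close>
    define c where "c = ip (f - g) d / ip d d"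
    have orth_B: "ip (f - (g + c *\<^sub>R d)) h = 0" if "h \<in> B" for h
    proof -
      have "h \<in> H" using that B by auto
      moreover have "ip (f - g) h = 0" "ip d h = 0"
        using that g_orth p_orth by (simp_all add: d_def)
      ultimately have "ip (f - g - c *\<^sub>R d) h = 0"
        using f gH d by (simp add: ip_diff_left[of "f - g"] ip_scale_left)
      then show ?thesis by (simp add: diff_diff_eq)
    qed
    have orth_d: "ip (f - (g + c *\<^sub>R d)) d = 0"
    proof (cases "d = 0")
      case True
      then show ?thesis using f gH by (simp add: ip_zero_right)
    next
      case False
      then have "ip d d \<noteq> 0" using ip_definite[OF d] by auto
      then have "ip (f - g - c *\<^sub>R d) d = 0"
        using f gH d by (simp add: ip_diff_left[of "f - g"] ip_scale_left c_def)
      then show ?thesis by (simp add: diff_diff_eq)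
    qed
    have res: "f - (g + c *\<^sub>R d) \<in> H"
      using f gH d by simp
    have "ip (f - (g + c *\<^sub>R d)) p = 0"
      by (rule orthogonal_span[OF res B orth_B p])
    then have orth_b: "ip (f - (g + c *\<^sub>R d)) b = 0"
      using orth_d ip_add_right[OF res d pH] by (simp add: d_def)
    have "span B \<subseteq> span (insert b B)"
      by (rule span_mono) auto
    then have "g + c *\<^sub>R d \<in> span (insert b B)"
      unfolding d_def using g p by (intro span_add span_scale span_diff) (auto simp: span_base)
    then show ?case
      using orth_B orth_b by (intro bexI[of _ "g + c *\<^sub>R d"]) auto
  qed
  then obtain g where g: "g \<in> span B" and orth: "\<forall>b \<in> B. ip (f - g) b = 0"
    by blast
  have "f - g \<in> H"
    using assms(3) g span_subset_H[OF assms(2)] by auto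
  then show ?thesis
    using g orth orthogonal_span[OF _ assms(2)] by blast
qed

lemma orth_projection_characterization:
  assumes N: "subspace N" "N \<subseteq> H" and f: "f \<in> H"
    and ex: "\<exists>g \<in> N. \<forall>h \<in> N. ip (f - g) h = 0"
  shows "orth_projection ip N f \<in> N \<and> (\<forall>h \<in> N. ip (f - orth_projection ip N f) h = 0)"
  unfolding orth_projection_def
proof (rule theI')
  show "\<exists>!g. g \<in> N \<and> (\<forall>h\<in>N. ip (f - g) h = 0)"
  proof (rule ex_ex1I)
    show "\<exists>g. g \<in> N \<and> (\<forall>h\<in>N. ip (f - g) h = 0)"
      using ex by blast
  next
    fix g g' assume g: "g \<in> N \<and> (\<forall>h\<in>N. ip (f - g) h = 0)"
      and g': "g' \<in> N \<and> (\<forall>h\<in>N. ip (f - g') h = 0)"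
    have d: "g - g' \<in> N"
      using g g' N(1) by (simp add: subspace_diff)
    have H: "g \<in> H" "g' \<in> H" using g g' N(2) by auto
    have "ip (g - g') (g - g') = ip (f - g') (g - g') - ip (f - g) (g - g')"
      using H f by (simp add: ip_diff_left)
    also have "\<dots> = 0" using g g' d by simp
    finally show "g = g'"
      using ip_definite[of "g - g'"] H by simp
  qed
qed

text \<open>
  The common form of the scalar-valued and the matrix-valued power function: \<open>r\<close> is the
  representer of the point evaluation. The functional \<open>f \<mapsto> \<langle>f - \<Pi> f, r\<rangle>\<close> equals
  \<open>f \<mapsto> \<langle>f, r - g\<rangle>\<close>, so its operator norm is the norm of \<open>r - g\<close>, attained at \<open>r - g\<close>
  unless that vanishes.
\<close>

lemma power_sup_squared:
  assumes B: "finite B" "B \<subseteq> H"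
    and r: "r \<in> H" and g: "g \<in> span B" and orth: "\<And>h. h \<in> span B \<Longrightarrow> ip (r - g) h = 0"
  shows "(if H = {0} then 0
      else SUP f\<in>H - {0}. \<bar>ip (f - orth_projection ip (span B) f) r\<bar> / ip_norm ip f)\<^sup>2
    = ip (r - g) r"
proof -
  define d where "d = r - g"
  have gH: "g \<in> H" using g span_subset_H[OF B(2)] by auto
  then have d: "d \<in> H" using r by (simp add: d_def)
  have "ip d d = ip d r - ip d g"
    using d r gH ip_diff_right[of d r g] by (simp add: d_def)
  then have residual: "ip (r - g) r = (ip_norm ip d)\<^sup>2"
    using orth[OF g] d by (simp add: ip_norm_squared d_def)
  show ?thesis
  proof (cases "H = {0}")
    case True
    then have "d = 0" using d by simp
    then show ?thesis
      using True residual by (simp add: ip_norm_def ip_zero_left)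
  next
    case False
    have functional: "ip (f - orth_projection ip (span B) f) r = ip f d" if f: "f \<in> H" for f
    proof -
      define p where "p = orth_projection ip (span B) f"
      have p: "p \<in> span B" and p_orth: "\<And>h. h \<in> span B \<Longrightarrow> ip (f - p) h = 0"
        using orth_projection_characterization[OF subspace_span span_subset_H[OF B(2)] f
            projection_exists[OF B f]]
        by (auto simp: p_def)
      have pH: "p \<in> H" using p span_subset_H[OF B(2)] by auto
      have "ip (f - p) r = ip (f - p) d + ip (f - p) g"
        using f pH d gH ip_add_right[of "f - p" d g] by (simp add: d_def)
      also have "\<dots> = ip f d - ip d p"
        using f pH d p_orth[OF g] by (simp add: ip_diff_left ip_commute[of d p])
      also have "\<dots> = ip f d"
        using orth[OF p] by (simp add: d_def)
      finally show ?thesis by (simp add: p_def)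
    qed
    have nonempty: "H - {0} \<noteq> {}"
      using False H_closed(1) by blast
    have bound: "\<bar>ip f d\<bar> / ip_norm ip f \<le> ip_norm ip d" if "f \<in> H - {0}" for f
      using that Cauchy_Schwarz[of f d] d ip_norm_pos[of f]
      by (simp add: divide_le_eq mult.commute)
    have "(SUP f\<in>H - {0}. \<bar>ip f d\<bar> / ip_norm ip f) = ip_norm ip d"
    proof (cases "d = 0")
      case True
      then have "(SUP f\<in>H - {0}. \<bar>ip f d\<bar> / ip_norm ip f) = (SUP f\<in>H - {0}. (0::real))"
        by (intro SUP_cong) (auto simp: ip_zero_right)
      then show ?thesis
        using nonempty True by (simp add: ip_norm_def ip_zero_left)
    next
      case d_nz: False
      show ?thesis
      proof (rule antisym)
        show "(SUP f\<in>H - {0}. \<bar>ip f d\<bar> / ip_norm ip f) \<le> ip_norm ip d"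
          using nonempty bound by (rule cSUP_least)
        have "bdd_above ((\<lambda>f. \<bar>ip f d\<bar> / ip_norm ip f) ` (H - {0}))"
          using bound by (rule bdd_aboveI2)
        then have "\<bar>ip d d\<bar> / ip_norm ip d \<le> (SUP f\<in>H - {0}. \<bar>ip f d\<bar> / ip_norm ip f)"
          using d d_nz by (intro cSUP_upper) auto
        moreover have "\<bar>ip d d\<bar> / ip_norm ip d = ip_norm ip d"
          using d ip_norm_pos[OF d d_nz] ip_nonneg[OF d]
          by (simp add: ip_norm_squared[symmetric] power2_eq_square)
        ultimately show "ip_norm ip d \<le> (SUP f\<in>H - {0}. \<bar>ip f d\<bar> / ip_norm ip f)"
          by simp
      qed
    qed
    moreover have "(SUP f\<in>H - {0}. \<bar>ip (f - orth_projection ip (span B) f) r\<bar> / ip_norm ip f)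
        = (SUP f\<in>H - {0}. \<bar>ip f d\<bar> / ip_norm ip f)"
      by (intro SUP_cong) (auto simp: functional)
    ultimately show ?thesis
      using False residual by simp
  qed
qed

end

section \<open>Power functions of reproducing kernel Hilbert spaces\<close>

lemma hilbert_function_space_inner_product:
  "hilbert_function_space H ip \<Longrightarrow> carrier_inner_product H ip"
  by (simp add: hilbert_function_space_def carrier_inner_product_def)

lemma power_function_squared:
  assumes rkhs: "is_rkhs k H ip" and B: "finite B" "B \<subseteq> H"
    and g: "g \<in> span B"
    and orth: "\<And>h. h \<in> span B \<Longrightarrow> ip ((\<lambda>y. k y x *v \<alpha>) - g) h = 0"
  shows "(power_function H ip (span B) \<alpha> x)\<^sup>2 = (k x x *v \<alpha> - g x) \<bullet> \<alpha>"
proof -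
  interpret carrier_inner_product H ip
    using rkhs by (simp add: is_rkhs_def hilbert_function_space_inner_product)
  define r where "r = (\<lambda>y. k y x *v \<alpha>)"
  have r: "r \<in> H" and repr: "\<And>f. f \<in> H \<Longrightarrow> ip f r = f x \<bullet> \<alpha>"
    using rkhs by (auto simp: is_rkhs_def r_def)
  have "f - orth_projection ip (span B) f \<in> H" if "f \<in> H" for f
    using orth_projection_characterization[OF subspace_span span_subset_H[OF B(2)] that
        projection_exists[OF B that]] span_subset_H[OF B(2)] that by auto
  then have "(SUP f\<in>H - {0}. \<bar>(f x - orth_projection ip (span B) f x) \<bullet> \<alpha>\<bar> / ip_norm ip f)
      = (SUP f\<in>H - {0}. \<bar>ip (f - orth_projection ip (span B) f) r\<bar> / ip_norm ip f)"
    by (intro SUP_cong) (auto simp: repr)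
  then have "(power_function H ip (span B) \<alpha> x)\<^sup>2 = ip (r - g) r"
    using power_sup_squared[OF B r g orth[folded r_def]] by (simp only: power_function_def)
  moreover have "r - g \<in> H"
    using r g span_subset_H[OF B(2)] by auto
  ultimately show ?thesis
    by (simp add: repr) (simp add: r_def)
qed

lemma scalar_power_function_squared:
  assumes rkhs: "is_scalar_rkhs k H ip" and B: "finite B" "B \<subseteq> H"
    and g: "g \<in> span B"
    and orth: "\<And>h. h \<in> span B \<Longrightarrow> ip ((\<lambda>y. k y x) - g) h = 0"
  shows "(scalar_power_function H ip (span B) x)\<^sup>2 = k x x - g x"
proof -
  interpret carrier_inner_product H ip
    using rkhs by (simp add: is_scalar_rkhs_def hilbert_function_space_inner_product)
  define r where "r = (\<lambda>y. k y x)"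
  have r: "r \<in> H" and repr: "\<And>f. f \<in> H \<Longrightarrow> ip f r = f x"
    using rkhs by (auto simp: is_scalar_rkhs_def r_def)
  have "f - orth_projection ip (span B) f \<in> H" if "f \<in> H" for f
    using orth_projection_characterization[OF subspace_span span_subset_H[OF B(2)] that
        projection_exists[OF B that]] span_subset_H[OF B(2)] that by auto
  then have "(SUP f\<in>H - {0}. \<bar>f x - orth_projection ip (span B) f x\<bar> / ip_norm ip f)
      = (SUP f\<in>H - {0}. \<bar>ip (f - orth_projection ip (span B) f) r\<bar> / ip_norm ip f)"
    by (intro SUP_cong) (auto simp: repr)
  then have "(scalar_power_function H ip (span B) x)\<^sup>2 = ip (r - g) r"
    using power_sup_squared[OF B r g orth[folded r_def]] by (simp only: scalar_power_function_def)
  moreover have "r - g \<in> H"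
    using r g span_subset_H[OF B(2)] by auto
  ultimately show ?thesis
    by (simp add: repr) (simp add: r_def)
qed

text \<open>
  The generators indexed by all \<open>\<beta> \<in> \<real>\<^sup>m\<close> can be thinned out to a basis of \<open>\<real>\<^sup>m\<close>; finiteness
  is what makes projections onto the trial space available.
\<close>

lemma kernel_span_finitely_generated:
  fixes k :: "'a \<Rightarrow> 'a \<Rightarrow> real^'m^'m"
  shows "span {(\<lambda>y. k y (xs j) *v \<beta>) | j \<beta>. j \<in> J}
    = span {(\<lambda>y. k y (xs j) *v b) | j b. j \<in> J \<and> b \<in> Basis}" (is "span ?A = span ?B")
proof (rule antisym)
  show "span ?B \<subseteq> span ?A"
    by (rule span_mono) auto
  have "?A \<subseteq> span ?B"
  proof clarify
    fix j \<beta> assume j: "j \<in> J"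
    define \<phi> where "\<phi> = (\<lambda>\<beta>. \<lambda>y. k y (xs j) *v \<beta>)"
    have "linear \<phi>"
      by (rule linearI)
        (auto simp: \<phi>_def scaleR_fun_def fun_eq_iff matrix_vector_right_distrib
          matrix_vector_mult_scaleR)
    then have "\<phi> ` UNIV = span (\<phi> ` Basis)"
      using linear_span_image[of \<phi> Basis] by simp
    moreover have "\<phi> ` Basis \<subseteq> ?B"
      using j by (auto simp: \<phi>_def)
    ultimately have "\<phi> \<beta> \<in> span ?B"
      using span_mono by blast
    then show "(\<lambda>y. k y (xs j) *v \<beta>) \<in> span ?B"
      by (simp add: \<phi>_def)
  qed
  then show "span ?A \<subseteq> span ?B"
    by (rule span_minimal) simp
qed

theorem lemma3p13:
  fixes k :: "'a \<Rightarrow> 'a \<Rightarrow> real^'m^'m"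
    and k\<^sub>1 :: "'a \<Rightarrow> 'a \<Rightarrow> real"
    and Q\<^sub>1 :: "real^'m^'m"
    and xs :: "nat \<Rightarrow> 'a" and n :: nat
    and H :: "('a \<Rightarrow> real^'m) set" and ip :: "('a \<Rightarrow> real^'m) \<Rightarrow> ('a \<Rightarrow> real^'m) \<Rightarrow> real"
    and H\<^sub>1 :: "('a \<Rightarrow> real) set" and ip\<^sub>1 :: "('a \<Rightarrow> real) \<Rightarrow> ('a \<Rightarrow> real) \<Rightarrow> real"
    and N :: "('a \<Rightarrow> real^'m) set" and N\<^sub>1 :: "('a \<Rightarrow> real) set"
    and x :: 'a and \<alpha> :: "real^'m"
  assumes "matrix_kernel k"
    and "separable_of_order k 1"
    and "kernel_decomposition k [(k\<^sub>1, Q\<^sub>1)]"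
    and "pos_def_scalar_kernel k\<^sub>1"
    and "psd_matrix Q\<^sub>1"
    and "inj_on xs {1..n}"
    and "is_rkhs k H ip"
    and "is_scalar_rkhs k\<^sub>1 H\<^sub>1 ip\<^sub>1"
    and "N = span {(\<lambda>y. k y (xs j) *v \<beta>) | j \<beta>. j \<in> {1..n}}"
    and "N\<^sub>1 = span {(\<lambda>y. k\<^sub>1 y (xs j)) | j. j \<in> {1..n}}"
  shows "(power_function H ip N \<alpha> x)\<^sup>2
    = (scalar_power_function H\<^sub>1 ip\<^sub>1 N\<^sub>1 x)\<^sup>2 * (\<alpha> \<bullet> (Q\<^sub>1 *v \<alpha>))"
proof -
  have k: "k y z = k\<^sub>1 y z *\<^sub>R Q\<^sub>1" for y z
    using assms(3) by (simp add: kernel_decomposition_def)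
  have kv: "k y z *v \<beta> = k\<^sub>1 y z *\<^sub>R (Q\<^sub>1 *v \<beta>)" for y z \<beta>
    by (simp add: k scaleR_matrix_vector_assoc)
  define B\<^sub>1 where "B\<^sub>1 = {(\<lambda>y. k\<^sub>1 y (xs j)) | j. j \<in> {1..n}}"
  define B where "B = {(\<lambda>y. k y (xs j) *v b) | j b. j \<in> {1..n} \<and> b \<in> Basis}"
  have N1: "N\<^sub>1 = span B\<^sub>1"
    using assms(10) by (simp add: B\<^sub>1_def)
  have N: "N = span B"
    using assms(9) kernel_span_finitely_generated[of k xs "{1..n}"] by (simp add: B_def)
  have fin: "finite B\<^sub>1" "finite B"
  proof -
    have "B\<^sub>1 = (\<lambda>j y. k\<^sub>1 y (xs j)) ` {1..n}"
      by (auto simp: B\<^sub>1_def)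
    then show "finite B\<^sub>1" by simp
    have "B = (\<lambda>(j, b) y. k y (xs j) *v b) ` ({1..n} \<times> Basis)"
      unfolding B_def by fast
    then show "finite B" by simp
  qed
  interpret V: carrier_inner_product H ip
    using assms(7) by (simp add: is_rkhs_def hilbert_function_space_inner_product)
  interpret S: carrier_inner_product H\<^sub>1 ip\<^sub>1
    using assms(8) by (simp add: is_scalar_rkhs_def hilbert_function_space_inner_product)
  have repr: "(\<lambda>y. k y z *v \<beta>) \<in> H" "f \<in> H \<Longrightarrow> ip f (\<lambda>y. k y z *v \<beta>) = f z \<bullet> \<beta>" for f z \<beta>
    using assms(7) by (auto simp: is_rkhs_def)
  have repr1: "(\<lambda>y. k\<^sub>1 y z) \<in> H\<^sub>1" "f \<in> H\<^sub>1 \<Longrightarrow> ip\<^sub>1 f (\<lambda>y. k\<^sub>1 y z) = f z" for f z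
    using assms(8) by (auto simp: is_scalar_rkhs_def)
  have BH: "B\<^sub>1 \<subseteq> H\<^sub>1" "B \<subseteq> H"
    using repr repr1 by (auto simp: B\<^sub>1_def B_def)
  obtain g\<^sub>1 where g1: "g\<^sub>1 \<in> span B\<^sub>1"
    and orth1: "\<And>h. h \<in> span B\<^sub>1 \<Longrightarrow> ip\<^sub>1 ((\<lambda>y. k\<^sub>1 y x) - g\<^sub>1) h = 0"
    using S.projection_exists[OF fin(1) BH(1) repr1(1)] by blast
  have scalar: "(scalar_power_function H\<^sub>1 ip\<^sub>1 N\<^sub>1 x)\<^sup>2 = k\<^sub>1 x x - g\<^sub>1 x"
    unfolding N1 by (rule scalar_power_function_squared[OF assms(8) fin(1) BH(1) g1 orth1])

  have interpolation: "k\<^sub>1 (xs j) x - g\<^sub>1 (xs j) = 0" if j: "j \<in> {1..n}" for j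
  proof -
    have "(\<lambda>y. k\<^sub>1 y x) - g\<^sub>1 \<in> H\<^sub>1"
      using repr1(1) g1 S.span_subset_H[OF BH(1)] by auto
    moreover have "(\<lambda>y. k\<^sub>1 y (xs j)) \<in> span B\<^sub>1"
      using j by (auto simp: B\<^sub>1_def intro!: span_base)
    ultimately show ?thesis
      using orth1 repr1(2)[of "(\<lambda>y. k\<^sub>1 y x) - g\<^sub>1" "xs j"] by simp
  qed

  \<comment> \<open>The scalar projection times \<open>Q\<^sub>1 \<alpha>\<close> is the projection of \<open>k(\<cdot>, x) \<alpha>\<close>.\<close>
  define g where "g = (\<lambda>y. g\<^sub>1 y *\<^sub>R (Q\<^sub>1 *v \<alpha>))"
  have g: "g \<in> span B"
  proof -
    define \<psi> where "\<psi> = (\<lambda>f (y :: 'a). (f y :: real) *\<^sub>R (Q\<^sub>1 *v \<alpha>) :: real^'m)"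
    have "linear \<psi>"
      by (rule linearI) (auto simp: \<psi>_def scaleR_fun_def fun_eq_iff scaleR_add_left)
    then have "\<psi> ` span B\<^sub>1 = span (\<psi> ` B\<^sub>1)"
      by (rule linear_span_image[symmetric])
    moreover have "\<psi> ` B\<^sub>1 \<subseteq> N"
    proof
      fix h assume "h \<in> \<psi> ` B\<^sub>1"
      then obtain j where "j \<in> {1..n}" "h = (\<lambda>y. k y (xs j) *v \<alpha>)"
        by (auto simp: B\<^sub>1_def \<psi>_def kv)
      then show "h \<in> N"
        unfolding assms(9) by (intro span_base) blast
    qed
    ultimately have "\<psi> ` span B\<^sub>1 \<subseteq> span B"
      unfolding N by (simp add: span_minimal)
    then show ?thesis
      using g1 by (auto simp: g_def \<psi>_def)
  qed
  have orth: "ip ((\<lambda>y. k y x *v \<alpha>) - g) h = 0" if "h \<in> span B" for h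
  proof (rule V.orthogonal_span[OF _ BH(2) _ that])
    show res: "(\<lambda>y. k y x *v \<alpha>) - g \<in> H"
      using repr(1) g V.span_subset_H[OF BH(2)] by auto
    fix b assume "b \<in> B"
    then obtain j \<beta> where j: "j \<in> {1..n}" and b: "b = (\<lambda>y. k y (xs j) *v \<beta>)"
      by (auto simp: B_def)
    have "((\<lambda>y. k y x *v \<alpha>) - g) (xs j) = (k\<^sub>1 (xs j) x - g\<^sub>1 (xs j)) *\<^sub>R (Q\<^sub>1 *v \<alpha>)"
      by (simp add: g_def kv scaleR_diff_left)
    then show "ip ((\<lambda>y. k y x *v \<alpha>) - g) b = 0"
      using interpolation[OF j] repr(2)[OF res] by (simp add: b)
  qed
  have "(power_function H ip N \<alpha> x)\<^sup>2 = (k x x *v \<alpha> - g x) \<bullet> \<alpha>"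
    unfolding N by (rule power_function_squared[OF assms(7) fin(2) BH(2) g orth])
  also have "\<dots> = (k\<^sub>1 x x - g\<^sub>1 x) * (\<alpha> \<bullet> (Q\<^sub>1 *v \<alpha>))"
    by (simp add: kv g_def inner_commute flip: scaleR_diff_left)
  finally show ?thesis
    by (simp add: scalar)
qed

end
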